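(* Let $D\ge 3$ and $R\le 2$, and let $\mathcal{A}=\sum_{r=1}^R\mathcal{A}_r$ be a Waring decomposition of an order-$D$ symmetric tensor $\mathcal{A}\in\mathbb{R}^{n\times\dots\times n}$. Then $$\kappa_{\mathcal{V}_{n,D}}(\mathcal{A}_1,\dots,\mathcal{A}_R)=\kappa_{\mathcal{S}_{n,D}}(\mathcal{A}_1,\dots,\mathcal{A}_R).$$
   Context: Tensors are real; $\|\cdot\|$ is the Euclidean (Frobenius) norm, and $\mathbb{S}^{n-1}=\{\mathbf{a}\in\mathbb{R}^n : \|\mathbf{a}\|_2=1\}$. For $\mathbf{a}\in\mathbb{R}^n$, $\mathbf{a}^{\otimes D}$ is the tensor product of $D$ copies of $\mathbf{a}$. A tensor is symmetric if its entries are invariant under all permutations of the indices. Decompositions. A canonical polyadic decomposition (CPD) of a tensor $\mathcal{A}\in\mathbb{R}^{n\times\dots\times n}$ of order $D$ is an expression $\mathcal{A}=\sum_{r=1}^R\mathcal{A}_r$ with $\mathcal{A}_r=\alpha_r\,\mathbf{a}_r^{(1)}\otimes\dots\otimes\mathbf{a}_r^{(D)}$, $\alpha_r\in\mathbb{R}\setminus\{0\}$, $\mathbf{a}_r^{(i)}\in\mathbb{S}^{n-1}$, where $R$ is minimal. A Waring decomposition is a CPD in which every summand is symmetric, i.e. $\mathcal{A}_r=\alpha_r\mathbf{a}_r^{\otimes D}$ with $\alpha_r\in\mathbb{R}\setminus\{0\}$ and $\mathbf{a}_r\in\mathbb{S}^{n-1}$. Manifolds. The Segre manifold is $\mathcal{S}_{n,D}=\{\alpha\,\mathbf{x}^{(1)}\otimes\dots\otimes\mathbf{x}^{(D)}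 : \alpha\in\mathbb{R}\setminus\{0\},\ \mathbf{x}^{(i)}\in\mathbb{S}^{n-1}\}$ and the Veronese manifold is $\mathcal{V}_{n,D}=\{\alpha\mathbf{x}^{\otimes D} : \alpha\in\mathbb{R}\setminus\{0\},\ \mathbf{x}\in\mathbb{S}^{n-1}\}$, both contained in the space $\mathbb{R}^{n\times\dots\times n}$ of order-$D$ tensors. Condition number. Let $\mathcal{M}$ be one of these manifolds, let $\mathfrak{a}=(\mathcal{A}_1,\dots,\mathcal{A}_R)\in\mathcal{M}^{\times R}$, let $\Sigma:\mathcal{M}^{\times R}\to\mathbb{R}^{n\times\dots\times n}$ be the addition map $(\mathcal{A}_1,\dots,\mathcal{A}_R)\mapsto\mathcal{A}_1+\dots+\mathcal{A}_R$, and put $\mathcal{A}=\Sigma(\mathfrak{a})$. If $\mathfrak{a}$ is an isolated decomposition of $\mathcal{A}$ and $\Sigma$ has a local inverse $\Sigma_{\mathfrak{a}}^{-1}$ at $\mathfrak{a}$, then $$\kappa_{\mathcal{M}}(\mathcal{A}_1,\dots,\mathcal{A}_R)=\lim_{\delta\to0}\ \sup_{\widetilde{\mathcal{A}}\in\Sigma(\mathcal{M}^{\times R}),\ \|\mathcal{A}-\widetilde{\mathcal{A}}\|\le\delta}\frac{\|\Sigma_{\mathfrak{a}}^{-1}(\mathcal{A})-\Sigma_{\mathfrak{a}}^{-1}(\widetilde{\mathcal{A}})\|}{\|\mathcal{A}-\widetilde{\mathcal{A}}\|},$$ and $\kappa_{\mathcal{M}}(\mathcal{A}_1,\dots,\mathcal{A}_R)=\infty$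 if $\mathfrak{a}$ is not isolated. By a known characterization, which may be taken as the working definition in all cases, $$\kappa_{\mathcal{M}}(\mathcal{A}_1,\dots,\mathcal{A}_R)=\sigma_{\min}\big([T_{\mathcal{A}_1}^{\mathcal{M}}\ \cdots\ T_{\mathcal{A}_R}^{\mathcal{M}}]\big)^{-1},$$ where the columns of $T_{\mathcal{A}_r}^{\mathcal{M}}$ form an orthonormal basis of the tangent space $T_{\mathcal{A}_r}\mathcal{M}$ (regarded as a linear subspace of the ambient tensor space), $\sigma_{\min}(T)=\min_{\|x\|=1}\|Tx\|$ is the smallest singular value, and $0^{-1}=\infty$. *)

theory Defs
  imports "HOL-Analysis.Analysis"
begin

text \<open>
  Real tensors of order \<open>D = CARD('d)\<close> with every dimension equal to \<open>n = CARD('n)\<close>.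
  An entry is addressed by a multi-index \<open>i :: 'd \<Rightarrow> 'n\<close>, so \<open>norm\<close> on this type is the
  Frobenius norm.
\<close>

type_synonym ('n, 'd) tensor = "real ^ ('d \<Rightarrow> 'n)"

definition tensor_prod :: "('d::finite \<Rightarrow> real ^ 'n::finite) \<Rightarrow> ('n, 'd) tensor" where
  "tensor_prod x = (\<chi> i. \<Prod>k\<in>UNIV. x k $ i k)"

definition tensor_power :: "real ^ 'n::finite \<Rightarrow> ('n, 'd::finite) tensor" where
  "tensor_power a = tensor_prod (\<lambda>_. a)"

definition symmetric_tensor :: "('n::finite, 'd::finite) tensor \<Rightarrow> bool" where
  "symmetric_tensor A \<longleftrightarrow> (\<forall>p :: 'd \<Rightarrow> 'd. bij p \<longrightarrow> (\<forall>i. A $ (i \<circ> p) = A $ i))"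

definition segre :: "('n::finite, 'd::finite) tensor set" where
  "segre = {\<alpha> *\<^sub>R tensor_prod x | \<alpha> x. \<alpha> \<noteq> 0 \<and> (\<forall>k. x k \<in> sphere 0 1)}"

definition veronese :: "('n::finite, 'd::finite) tensor set" where
  "veronese = {\<alpha> *\<^sub>R tensor_power x | \<alpha> x. \<alpha> \<noteq> 0 \<and> x \<in> sphere 0 1}"

text \<open>The number of summands is minimal among all decompositions into rank-one tensors,
  not only among the symmetric ones.\<close>

definition cp_decomposition ::
    "('n::finite, 'd::finite) tensor \<Rightarrow> ('n, 'd) tensor list \<Rightarrow> bool" where
  "cp_decomposition A As \<longleftrightarrow>
     set As \<subseteq> segre \<and> A = sum_list As \<and>
     (\<forall>Bs. set Bs \<subseteq> segre \<and> A = sum_list Bs \<longrightarrow> length As \<le> length Bs)"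

definition waring_decomposition ::
    "('n::finite, 'd::finite) tensor \<Rightarrow> ('n, 'd) tensor list \<Rightarrow> bool" where
  "waring_decomposition A As \<longleftrightarrow> cp_decomposition A As \<and> set As \<subseteq> veronese"

text \<open>The tangent space at \<open>p\<close> of an embedded submanifold \<open>M\<close> of a Euclidean space, as a linear
  subspace of the ambient space: the velocities at \<open>p\<close> of \<open>C\<^sup>1\<close> curves in \<open>M\<close>.\<close>

definition tangent_space :: "'a::euclidean_space set \<Rightarrow> 'a \<Rightarrow> 'a set" where
  "tangent_space M p =
     {v. \<exists>\<epsilon>>0. \<exists>\<gamma>. \<gamma> C1_differentiable_on {-\<epsilon><..<\<epsilon>} \<and> \<gamma> ` {-\<epsilon><..<\<epsilon>} \<subseteq> M \<and>
                  \<gamma> 0 = p \<and> (\<gamma> has_vector_derivative v) (at 0)}"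

definition orthonormal_basis_of :: "'a::euclidean_space set \<Rightarrow> 'a list \<Rightarrow> bool" where
  "orthonormal_basis_of U B \<longleftrightarrow>
     (\<forall>i<length B. \<forall>j<length B. B ! i \<bullet> B ! j = (if i = j then 1 else 0)) \<and>
     span (set B) = U"

text \<open>A matrix \<open>T\<close> is represented by the list of its columns, and a vector \<open>x\<close> of matching
  dimension by its coordinates at the indices below \<open>length T\<close>.  The infimum is a minimum
  unless \<open>T\<close> has no columns; in that case it is \<open>\<top>\<close>.\<close>

definition sigma_min :: "'a::euclidean_space list \<Rightarrow> ennreal" where
  "sigma_min T =
     Inf {ennreal (norm (\<Sum>j<length T. x j *\<^sub>R T ! j)) | x. L2_set x {..<length T} = 1}"

text \<open>The condition number of the addition map on \<open>M\<times>\<dots>\<times>M\<close> at \<open>As\<close>, through its characterization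
  by the matrix whose columns are orthonormal bases of the tangent spaces at the summands.
  Any other choice of orthonormal bases multiplies the matrix by an orthogonal matrix from
  the right, which does not change \<open>sigma_min\<close>.  In \<open>ennreal\<close>, \<open>inverse 0 = \<top>\<close>.\<close>

definition condition_number :: "'a::euclidean_space set \<Rightarrow> 'a list \<Rightarrow> ennreal" where
  "condition_number M As =
     inverse (sigma_min (concat (map (\<lambda>A. SOME B. orthonormal_basis_of (tangent_space M A) B) As)))"

end

theory Submission
  imports Defs
begin

text \<open>
  At \<open>\<alpha> a\<^sup>\<otimes>\<^sup>D\<close> the Segre tangent space consists of the tensors
  \<open>\<Sum>\<^sub>k a \<otimes> \<dots> \<otimes> u\<^sub>k \<otimes> \<dots> \<otimes> a\<close>, and the Veronese tangent space is the part with all \<open>u\<^sub>k\<close>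
  equal. Splitting a family \<open>u\<close> into its mean and a remainder with zero sum decomposes both
  Segre tangent spaces orthogonally, and the symmetric part of one is orthogonal to the
  zero-sum part of the other. With \<open>c = \<langle>a, b\<rangle>\<close>, the cosine of any angle between the
  two zero-sum parts is at most \<open>\<bar>c\<bar>\<close> to the power \<open>D - 2\<close>. The symmetric parts contain an
  explicit pair whose cosine is at least that large in modulus, so the zero-sum parts never
  decrease the smallest singular value.
\<close>

section \<open>Smallest singular values in terms of subspaces\<close>

lemma sum_lessThan_add_split:
  fixes f :: "nat \<Rightarrow> 'a::comm_monoid_add"
  shows "(\<Sum>j<m + k. f j) = (\<Sum>j<m. f j) + (\<Sum>j<k. f (m + j))"
  by (induction k) (auto simp: add.assoc)

lemma orthonormal_basis_of_exists:
  fixes U :: "'a::euclidean_space set"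
  assumes "subspace U"
  shows "\<exists>B. orthonormal_basis_of U B"
proof -
  obtain B where B: "B \<subseteq> U" "pairwise orthogonal B" "\<And>x. x \<in> B \<Longrightarrow> norm x = 1"
      "independent B" "span B = U"
    using orthonormal_basis_subspace[OF assms] by metis
  obtain Bs where Bs: "set Bs = B" "distinct Bs"
    using finite_distinct_list[of B] B(4) independent_imp_finite by blast
  have "Bs ! i \<bullet> Bs ! j = (if i = j then 1 else 0)" if "i < length Bs" "j < length Bs" for i j
  proof (cases "i = j")
    case True
    then show ?thesis using B(3) Bs(1) that nth_mem by (fastforce simp: dot_square_norm)
  next
    case False
    then have "Bs ! i \<noteq> Bs ! j" using Bs(2) that nth_eq_iff_index_eq by blast
    then show ?thesis
      using B(2) Bs(1) that False nth_mem unfolding pairwise_def orthogonal_def by metis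
  qed
  then show ?thesis
    using B(5) Bs(1) unfolding orthonormal_basis_of_def by blast
qed

lemma orthonormal_basis_of_empty: "orthonormal_basis_of {0} []"
  by (simp add: orthonormal_basis_of_def)

lemma orthonormal_basis_of_coordinates:
  assumes "orthonormal_basis_of U B"
  shows "U = range (\<lambda>x. \<Sum>j<length B. x j *\<^sub>R B ! j)"
proof
  have sp: "span (set B) = U"
    and orth: "\<And>i j. i < length B \<Longrightarrow> j < length B \<Longrightarrow> B ! i \<bullet> B ! j = (if i = j then 1 else 0)"
    using assms by (auto simp: orthonormal_basis_of_def)
  \<comment> \<open>\<open>?P\<close> holds the vectors equal to their own orthonormal expansion. It
    is a subspace containing \<open>B\<close>, hence it contains the span.\<close>
  let ?P = "{u. u = (\<Sum>j<length B. (u \<bullet> B ! j) *\<^sub>R B ! j)}"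
  have "U \<subseteq> ?P"
    unfolding sp[symmetric]
  proof (rule span_minimal)
    show "set B \<subseteq> ?P"
    proof
      fix u assume "u \<in> set B"
      then obtain i where i: "i < length B" "u = B ! i" by (metis in_set_conv_nth)
      have "(\<Sum>j<length B. (u \<bullet> B ! j) *\<^sub>R B ! j) = (\<Sum>j<length B. if i = j then B ! j else 0)"
        by (rule sum.cong) (use i orth in auto)
      then show "u \<in> ?P" using i by simp
    qed
    show "subspace ?P"
      by (rule subspaceI)
        (simp_all add: inner_add_left scaleR_add_left sum.distrib flip: scaleR_scaleR scaleR_sum_right)
  qed
  then show "U \<subseteq> range (\<lambda>x. \<Sum>j<length B. x j *\<^sub>R B ! j)"
    by (intro subsetI image_eqI[where f = "\<lambda>x. \<Sum>j<length B. x j *\<^sub>R B ! j"]) auto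
  show "range (\<lambda>x. \<Sum>j<length B. x j *\<^sub>R B ! j) \<subseteq> U"
    unfolding sp[symmetric] by (intro image_subsetI span_sum span_scale span_base) simp
qed

lemma orthonormal_basis_of_norm:
  assumes "orthonormal_basis_of U B"
  shows "(norm (\<Sum>j<length B. x j *\<^sub>R B ! j))\<^sup>2 = (\<Sum>j<length B. (x j)\<^sup>2)"
proof -
  have orth: "\<And>i j. i < length B \<Longrightarrow> j < length B \<Longrightarrow> B ! i \<bullet> B ! j = (if i = j then 1 else 0)"
    using assms by (auto simp: orthonormal_basis_of_def)
  have "(norm (\<Sum>j<length B. x j *\<^sub>R B ! j))\<^sup>2
      = (\<Sum>i<length B. \<Sum>j<length B. x j * (x i * (B ! i \<bullet> B ! j)))"
    unfolding power2_norm_eq_inner inner_sum_left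
    by (simp add: inner_sum_right sum_distrib_left)
  also have "\<dots> = (\<Sum>i<length B. \<Sum>j<length B. if i = j then x i * x j else 0)"
    by (intro sum.cong refl) (auto simp: orth)
  also have "\<dots> = (\<Sum>j<length B. (x j)\<^sup>2)"
    by (simp add: power2_eq_square)
  finally show ?thesis .
qed

text \<open>Coordinates with respect to an orthonormal basis are isometric, so unit coordinate
  vectors of the joint matrix match pairs in \<open>U\<close> and \<open>W\<close> with squared
  norms adding to 1. The value therefore depends on the subspaces alone, not on the bases that
  \<open>SOME\<close> selects.\<close>

lemma sigma_min_append:
  assumes B: "orthonormal_basis_of U B" and C: "orthonormal_basis_of W C"
  shows "sigma_min (B @ C) =
    Inf {ennreal (norm (u + w)) | u w. u \<in> U \<and> w \<in> W \<and> (norm u)\<^sup>2 + (norm w)\<^sup>2 = 1}"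
proof -
  let ?m = "length B" and ?k = "length C"
  let ?S = "\<lambda>x. \<Sum>j<?m. x j *\<^sub>R B ! j" and ?T = "\<lambda>y. \<Sum>j<?k. y j *\<^sub>R C ! j"
  have sum: "(\<Sum>j<length (B @ C). x j *\<^sub>R (B @ C) ! j) = ?S x + ?T (\<lambda>j. x (?m + j))" for x
    by (simp add: sum_lessThan_add_split nth_append)
  have L2: "L2_set x {..<length (B @ C)} = 1 \<longleftrightarrow>
      (norm (?S x))\<^sup>2 + (norm (?T (\<lambda>j. x (?m + j))))\<^sup>2 = 1" for x
    by (simp add: L2_set_def sum_lessThan_add_split orthonormal_basis_of_norm[OF B]
        orthonormal_basis_of_norm[OF C])
  have "{ennreal (norm (\<Sum>j<length (B @ C). x j *\<^sub>R (B @ C) ! j)) | x.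
          L2_set x {..<length (B @ C)} = 1}
      = {ennreal (norm (u + w)) | u w. u \<in> U \<and> w \<in> W \<and> (norm u)\<^sup>2 + (norm w)\<^sup>2 = 1}"
    (is "?L = ?R")
  proof
    show "?L \<subseteq> ?R"
    proof
      fix e assume "e \<in> ?L"
      then obtain x where "e = ennreal (norm (?S x + ?T (\<lambda>j. x (?m + j))))"
          and "(norm (?S x))\<^sup>2 + (norm (?T (\<lambda>j. x (?m + j))))\<^sup>2 = 1"
        unfolding sum L2 by blast
      then show "e \<in> ?R"
        unfolding orthonormal_basis_of_coordinates[OF B] orthonormal_basis_of_coordinates[OF C]
        by (intro CollectI exI[of _ "?S x"] exI[of _ "?T (\<lambda>j. x (?m + j))"] conjI rangeI)
    qed
    show "?R \<subseteq> ?L"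
    proof
      fix e assume "e \<in> ?R"
      then obtain x y where e: "e = ennreal (norm (?S x + ?T y))"
          and 1: "(norm (?S x))\<^sup>2 + (norm (?T y))\<^sup>2 = 1"
        unfolding orthonormal_basis_of_coordinates[OF B] orthonormal_basis_of_coordinates[OF C]
        by blast
      let ?z = "\<lambda>j. if j < ?m then x j else y (j - ?m)"
      have "?S ?z = ?S x" "?T (\<lambda>j. ?z (?m + j)) = ?T y" by simp_all
      then show "e \<in> ?L" unfolding sum L2 using e 1 by (intro CollectI exI[of _ ?z]) simp
    qed
  qed
  then show ?thesis unfolding sigma_min_def by simp
qed

text \<open>Squaring and rescaling turn a lower bound for the infimum into a homogeneous inequality
  free of the normalization. \<open>bound\<close> transfers that inequality to the larger spaces and
  is applied with the square of the infimum over \<open>V\<close> and \<open>W\<close>.\<close>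

lemma Inf_norm_sum_eqI:
  fixes V W V' W' :: "'a::real_inner set"
  assumes sub: "V \<subseteq> V'" "W \<subseteq> W'" and V: "subspace V" "subspace W" and x: "x \<in> V" "x \<noteq> 0"
    and bound: "\<And>m u w. (\<And>u w. u \<in> V \<Longrightarrow> w \<in> W \<Longrightarrow> m * ((norm u)\<^sup>2 + (norm w)\<^sup>2) \<le> (norm (u + w))\<^sup>2)
      \<Longrightarrow> u \<in> V' \<Longrightarrow> w \<in> W' \<Longrightarrow> m * ((norm u)\<^sup>2 + (norm w)\<^sup>2) \<le> (norm (u + w))\<^sup>2"
  shows "Inf {ennreal (norm (u + w)) | u w. u \<in> V \<and> w \<in> W \<and> (norm u)\<^sup>2 + (norm w)\<^sup>2 = 1}
       = Inf {ennreal (norm (u + w)) | u w. u \<in> V' \<and> w \<in> W' \<and> (norm u)\<^sup>2 + (norm w)\<^sup>2 = 1}"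
    (is "Inf ?I = Inf ?J")
proof (rule antisym)
  show "Inf ?J \<le> Inf ?I" by (rule Inf_superset_mono) (use sub in blast)
  show "Inf ?I \<le> Inf ?J"
  proof (rule Inf_greatest)
    fix e assume "e \<in> ?J"
    then obtain u w where e: "e = ennreal (norm (u + w))" "u \<in> V'" "w \<in> W'"
      "(norm u)\<^sup>2 + (norm w)\<^sup>2 = 1" by blast
    \<comment> \<open>The normalized \<open>x\<close> shows that \<open>?I\<close> is nonempty; an
      empty infimum would be \<open>top\<close> and could not be written as a real
      \<open>m\<close>.\<close>
    have "ennreal (norm ((1 / norm x) *\<^sub>R x + 0)) \<in> ?I"
      using x V by (intro CollectI exI[of _ "(1 / norm x) *\<^sub>R x"] exI[of _ 0])
        (auto simp: subspace_scale subspace_0)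
    then have "Inf ?I \<le> ennreal (norm ((1 / norm x) *\<^sub>R x + 0))" by (rule Inf_lower)
    then have "Inf ?I < top" using ennreal_less_top order_le_less_trans by blast
    then obtain m where m: "m \<ge> 0" "Inf ?I = ennreal m" by (cases "Inf ?I") auto
    have "m\<^sup>2 * ((norm u)\<^sup>2 + (norm w)\<^sup>2) \<le> (norm (u + w))\<^sup>2"
    proof (rule bound[OF _ e(2,3)])
      fix u w assume uw: "u \<in> V" "w \<in> W"
      define r where "r = sqrt ((norm u)\<^sup>2 + (norm w)\<^sup>2)"
      have r2: "r\<^sup>2 = (norm u)\<^sup>2 + (norm w)\<^sup>2" and r0: "r \<ge> 0" by (simp_all add: r_def)
      show "m\<^sup>2 * ((norm u)\<^sup>2 + (norm w)\<^sup>2) \<le> (norm (u + w))\<^sup>2"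
      proof (cases "r = 0")
        case True
        then show ?thesis using r2 by simp
      next
        case False
        have "ennreal (norm ((1 / r) *\<^sub>R u + (1 / r) *\<^sub>R w)) \<in> ?I"
          using uw V False r2
          by (intro CollectI exI[of _ "(1 / r) *\<^sub>R u"] exI[of _ "(1 / r) *\<^sub>R w"])
            (auto simp: subspace_scale power_divide simp flip: add_divide_distrib)
        then have "ennreal m \<le> ennreal (norm ((1 / r) *\<^sub>R u + (1 / r) *\<^sub>R w))"
          unfolding m(2)[symmetric] by (rule Inf_lower)
        then have "m \<le> norm ((1 / r) *\<^sub>R (u + w))" by (simp add: scaleR_add_right)
        then have "m \<le> norm (u + w) / r" using r0 by (simp del: scaleR_add_right)
        then have "m * r \<le> norm (u + w)" using r0 False by (simp add: pos_le_divide_eq)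
        then have "(m * r)\<^sup>2 \<le> (norm (u + w))\<^sup>2" using m r0 by (intro power_mono) auto
        then show ?thesis using r2 by (simp add: power_mult_distrib)
      qed
    qed
    then have "m\<^sup>2 \<le> (norm (u + w))\<^sup>2" using e by simp
    then have "m \<le> norm (u + w)" by (rule power2_le_imp_le) simp
    then show "Inf ?I \<le> e" using m e by (simp add: ennreal_leI)
  qed
qed

section \<open>Tangent vectors at a power and their inner products\<close>

text \<open>The derivative at \<open>t = 0\<close> of the product with factors
  \<open>a + t *\<^sub>R u k\<close>. The directions \<open>u k\<close> are not restricted to the
  orthogonal complement of \<open>a\<close>: this keeps the map linear on all families, at the price
  of a kernel (for instance multiples of \<open>a\<close> whose coefficients sum to zero).\<close>

definition tangent_map ::
    "real ^ 'n::finite \<Rightarrow> ('d::finite \<Rightarrow> real ^ 'n) \<Rightarrow> ('n, 'd) tensor" where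
  "tangent_map a u = (\<Sum>k\<in>UNIV. tensor_prod ((\<lambda>_. a)(k := u k)))"

lemma tensor_prod_inner:
  "tensor_prod x \<bullet> tensor_prod y = (\<Prod>k\<in>UNIV. x k \<bullet> y k)"
  by (simp add: tensor_prod_def inner_vec_def prod_sum_PiE flip: prod.distrib)

text \<open>A general \<open>f\<close> lets one identity serve both the entries of an updated
  product and inner products with it.\<close>

lemma prod_fun_upd:
  fixes f :: "'a \<Rightarrow> 'b::finite \<Rightarrow> 'c::comm_monoid_mult"
  shows "(\<Prod>l\<in>UNIV. f ((x(k := y)) l) l) = f y k * (\<Prod>l\<in>UNIV - {k}. f (x l) l)"
  by (subst prod.remove[of UNIV k]) (auto intro!: arg_cong2[where f = "(*)"] prod.cong)

lemma tangent_map_nth: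
  "tangent_map a u $ i = (\<Sum>k\<in>UNIV. u k $ i k * (\<Prod>l\<in>UNIV - {k}. a $ i l))"
  by (simp add: tangent_map_def tensor_prod_def prod_fun_upd[where f = "\<lambda>v l. v $ i l"]
      del: fun_upd_apply)

lemma tangent_map_add:
  "tangent_map a (\<lambda>k. u k + w k) = tangent_map a u + tangent_map a w"
  by (simp add: vec_eq_iff tangent_map_nth sum.distrib distrib_right)

lemma tangent_map_diff:
  "tangent_map a (\<lambda>k. u k - w k) = tangent_map a u - tangent_map a w"
  by (simp add: vec_eq_iff tangent_map_nth sum_subtractf left_diff_distrib)

lemma tangent_map_scaleR:
  "tangent_map a (\<lambda>k. s *\<^sub>R u k) = s *\<^sub>R tangent_map a u"
  by (simp add: vec_eq_iff tangent_map_nth sum_distrib_left mult.assoc)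

lemma tangent_map_self:
  "tangent_map a (\<lambda>_ :: 'd. a) = real CARD('d::finite) *\<^sub>R tensor_power a"
  by (simp add: tangent_map_def tensor_power_def fun_upd_idem sum_constant_scaleR
      del: fun_upd_apply sum_constant)

text \<open>In the double sum over slots \<open>k\<close> and \<open>l\<close>, an off-diagonal term
  replaces two factors \<open>c\<close> by \<open>u k \<bullet> b\<close> and
  \<open>a \<bullet> w l\<close>, while a diagonal term replaces just one. Completing the
  off-diagonal part to a full product of sums leaves the diagonal correction in the second
  sum.\<close>

lemma tangent_map_inner:
  fixes a b :: "real ^ 'n::finite" and u w :: "'d::finite \<Rightarrow> real ^ 'n"
  assumes "CARD('d) \<ge> 2"
  defines "c \<equiv> a \<bullet> b"
  shows "tangent_map a u \<bullet> tangent_map b w =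
    c ^ (CARD('d) - 2) * ((\<Sum>k\<in>UNIV. u k \<bullet> b) * (\<Sum>k\<in>UNIV. a \<bullet> w k)
      + (\<Sum>k\<in>UNIV. c * (u k \<bullet> w k) - (u k \<bullet> b) * (a \<bullet> w k)))"
proof -
  let ?p = "c ^ (CARD('d) - 2)"
  let ?t = "\<lambda>k l. tensor_prod ((\<lambda>_. a)(k := u k)) \<bullet> tensor_prod ((\<lambda>_. b)(l := w l))"
  have diag: "?t k k = ?p * (c * (u k \<bullet> w k))" for k
  proof -
    have "?t k k = (u k \<bullet> w k) * c ^ (CARD('d) - 1)"
      unfolding tensor_prod_inner
      by (subst prod.remove[of UNIV k]) (simp_all add: c_def card_Diff_singleton)
    also have "c ^ (CARD('d) - 1) = c * ?p"
      using assms(1) by (simp flip: power_Suc add: numeral_2_eq_2 Suc_diff_Suc)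
    finally show ?thesis by (simp del: fun_upd_apply)
  qed
  have off: "?t k l = ?p * ((u k \<bullet> b) * (a \<bullet> w l))" if "l \<noteq> k" for k l
  proof -
    have "?t k l = (u k \<bullet> b) * ((a \<bullet> w l) * c ^ (CARD('d) - 2))"
      unfolding tensor_prod_inner
      apply (subst prod.remove[of UNIV k], simp, simp)
      apply (subst prod.remove[of _ l])
      using that by (simp_all add: c_def card_Diff_singleton numeral_2_eq_2)
    then show ?thesis by simp
  qed
  have row: "(\<Sum>l\<in>UNIV. ?t k l) =
      ?p * ((u k \<bullet> b) * (\<Sum>l\<in>UNIV. a \<bullet> w l) + (c * (u k \<bullet> w k) - (u k \<bullet> b) * (a \<bullet> w k)))" for k
  proof -
    have "(\<Sum>l\<in>UNIV. ?t k l) = ?p * (c * (u k \<bullet> w k)) + (\<Sum>l\<in>UNIV - {k}. ?p * ((u k \<bullet> b) * (a \<bullet> w l)))"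
      by (subst sum.remove[of UNIV k]) (simp_all only: diag, auto intro!: sum.cong off)
    also have "(\<Sum>l\<in>UNIV - {k}. ?p * ((u k \<bullet> b) * (a \<bullet> w l)))
        = ?p * ((u k \<bullet> b) * ((\<Sum>l\<in>UNIV. a \<bullet> w l) - a \<bullet> w k))"
      by (simp add: sum_diff1 flip: sum_distrib_left)
    finally show ?thesis by (simp add: algebra_simps del: fun_upd_apply)
  qed
  have "tangent_map a u \<bullet> tangent_map b w = (\<Sum>k\<in>UNIV. \<Sum>l\<in>UNIV. ?t k l)"
    unfolding tangent_map_def inner_sum_left by (simp only: inner_sum_right)
  then show ?thesis
    by (simp only: row sum_distrib_left[symmetric] sum_distrib_right[symmetric] sum.distrib)
qed

text \<open>A vanishing sum removes the product of sums from \<open>tangent_map_inner\<close>; what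
  remains is controlled by Cauchy-Schwarz.\<close>

lemma tangent_map_zero_sum_bound:
  fixes a b :: "real ^ 'n::finite" and u w :: "'d::finite \<Rightarrow> real ^ 'n"
  assumes D: "CARD('d) \<ge> 2" and unit: "norm a = 1" "norm b = 1"
    and u: "(\<Sum>k\<in>UNIV. u k) = 0" and w: "(\<Sum>k\<in>UNIV. w k) = 0"
  shows "\<bar>tangent_map a u \<bullet> tangent_map b w\<bar>
    \<le> \<bar>a \<bullet> b\<bar> ^ (CARD('d) - 2) * norm (tangent_map a u) * norm (tangent_map b w)"
proof -
  \<comment> \<open>\<open>X a u\<close> collects the bivectors \<open>a \<and> u\<^sub>k\<close>; zero-sum tangent vectors pair like these, up to
    the factor \<open>(a \<bullet> b) ^ (D - 2)\<close>.\<close>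
  define X :: "real ^ 'n \<Rightarrow> ('d \<Rightarrow> real ^ 'n) \<Rightarrow> real ^ 'n ^ 'n ^ 'd" where
    "X a u = (\<chi> k i j. a $ i * u k $ j - a $ j * u k $ i)" for a u
  \<comment> \<open>The Binet-Cauchy identity in each slot. The factor 2 arises because an
    antisymmetric matrix lists every coordinate of a bivector twice.\<close>
  have X: "X p y \<bullet> X q z = 2 * (\<Sum>k\<in>UNIV. (p \<bullet> q) * (y k \<bullet> z k) - (y k \<bullet> q) * (p \<bullet> z k))" for p q y z
  proof -
    have "(\<Sum>i\<in>UNIV. \<Sum>j\<in>UNIV. (p $ i * y k $ j - p $ j * y k $ i) * (q $ i * z k $ j - q $ j * z k $ i))
       = 2 * ((p \<bullet> q) * (y k \<bullet> z k) - (y k \<bullet> q) * (p \<bullet> z k))" for k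
    proof -
      have "(\<Sum>i\<in>UNIV. \<Sum>j\<in>UNIV. (p $ i * y k $ j - p $ j * y k $ i) * (q $ i * z k $ j - q $ j * z k $ i))
        = (\<Sum>i\<in>UNIV. \<Sum>j\<in>UNIV. (p $ i * q $ i) * (y k $ j * z k $ j))
        + (\<Sum>i\<in>UNIV. \<Sum>j\<in>UNIV. (y k $ i * z k $ i) * (p $ j * q $ j))
        - (\<Sum>i\<in>UNIV. \<Sum>j\<in>UNIV. (p $ i * z k $ i) * (y k $ j * q $ j))
        - (\<Sum>i\<in>UNIV. \<Sum>j\<in>UNIV. (y k $ i * q $ i) * (p $ j * z k $ j))"
        by (simp add: algebra_simps flip: sum.distrib sum_subtractf)
      also have "\<dots> = 2 * ((p \<bullet> q) * (y k \<bullet> z k) - (y k \<bullet> q) * (p \<bullet> z k))"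
        by (simp only: sum_product[symmetric] inner_vec_def inner_real_def) (simp add: algebra_simps)
      finally show ?thesis .
    qed
    then show ?thesis
      by (simp add: X_def inner_vec_def sum_distrib_left)
  qed
  have T: "tangent_map p y \<bullet> tangent_map q z = (p \<bullet> q) ^ (CARD('d) - 2) * (X p y \<bullet> X q z / 2)"
    if "(\<Sum>k\<in>UNIV. y k) = 0" for p q and y z :: "'d \<Rightarrow> real ^ 'n"
    using that by (simp add: tangent_map_inner[OF D] X flip: inner_sum_left)
  \<comment> \<open>For equal unit base points the power in \<open>T\<close> is 1, so both norms
    agree up to \<open>sqrt 2\<close>.\<close>
  have nrm: "norm (X p y) = sqrt 2 * norm (tangent_map p y)"
    if "(\<Sum>k\<in>UNIV. y k) = 0" "norm p = 1" for p and y :: "'d \<Rightarrow> real ^ 'n"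
  proof -
    have "p \<bullet> p = 1" using that by (simp add: dot_square_norm)
    then have "X p y \<bullet> X p y = 2 * (tangent_map p y \<bullet> tangent_map p y)"
      using T[OF that(1), of p p y] by simp
    then show ?thesis by (simp add: norm_eq_sqrt_inner real_sqrt_mult)
  qed
  have "sqrt 2 * x * (sqrt 2 * y) = (sqrt 2 * sqrt 2) * (x * y)" for x y :: real
    by (simp only: mult_ac)
  then have "norm (X a u) * norm (X b w) = 2 * (norm (tangent_map a u) * norm (tangent_map b w))"
    using nrm[OF u unit(1)] nrm[OF w unit(2)] by simp
  then have "\<bar>X a u \<bullet> X b w\<bar> / 2 \<le> norm (tangent_map a u) * norm (tangent_map b w)"
    using Cauchy_Schwarz_ineq2[of "X a u" "X b w"] by simp
  then show ?thesis
    by (simp add: T[OF u] abs_mult power_abs mult_left_mono mult.assoc)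
qed

text \<open>Testing \<open>sym\<close> on one explicit pair bounds \<open>m\<close> by the constant
  that \<open>tangent_map_zero_sum_bound\<close> provides for the zero-sum parts. Those parts then
  satisfy the same inequality, and orthogonality lets the two inequalities be added.\<close>

lemma norm_add_sq_bound_extend:
  fixes a b :: "real ^ 'n::finite" and u w :: "'d::finite \<Rightarrow> real ^ 'n"
  assumes D: "CARD('d) \<ge> 2" and unit: "norm a = 1" "norm b = 1"
    and sym: "\<And>x y. m * ((norm (tangent_map a (\<lambda>_ :: 'd. x)))\<^sup>2 + (norm (tangent_map b (\<lambda>_ :: 'd. y)))\<^sup>2)
      \<le> (norm (tangent_map a (\<lambda>_ :: 'd. x) + tangent_map b (\<lambda>_ :: 'd. y)))\<^sup>2"
  shows "m * ((norm (tangent_map a u))\<^sup>2 + (norm (tangent_map b w))\<^sup>2)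
    \<le> (norm (tangent_map a u + tangent_map b w))\<^sup>2"
proof -
  let ?N = "real CARD('d)"
  define c where "c = a \<bullet> b"
  define \<rho> where "\<rho> = \<bar>c\<bar> ^ (CARD('d) - 2)"
  have aa: "a \<bullet> a = 1" "b \<bullet> b = 1" using unit by (simp_all add: dot_square_norm)
  have ba: "b \<bullet> a = c" "a \<bullet> b = c" by (simp_all add: c_def inner_commute)
  have c1: "c\<^sup>2 \<le> 1" using Cauchy_Schwarz_ineq[of a b] aa by (simp add: c_def)
  have N: "?N \<ge> 2" using D by simp
  have m_le: "m \<le> 1 - \<rho>"
  proof -
    \<comment> \<open>The pair with crossed directions \<open>b\<close> at \<open>a\<close> and \<open>a\<close> at \<open>b\<close> attains a cosine of modulus
      at least \<open>\<rho>\<close>.\<close>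
    define p q where "p = tangent_map a (\<lambda>_ :: 'd. b)" and "q = tangent_map b (\<lambda>_ :: 'd. a)"
    define r where "r = ?N * (1 + (?N - 1) * c\<^sup>2)"
    have pp: "p \<bullet> p = r" "q \<bullet> q = r"
      unfolding p_def q_def
      by (simp_all add: tangent_map_inner[OF D] aa ba r_def power2_eq_square algebra_simps)
    have pq: "p \<bullet> q = c ^ (CARD('d) - 2) * (?N * (c\<^sup>2 + (?N - 1)))"
      unfolding p_def q_def
      by (simp add: tangent_map_inner[OF D] aa ba power2_eq_square algebra_simps)
    \<comment> \<open>The difference of the two sides is
      \<open>?N * (?N - 2) * (1 - c\<^sup>2)\<close>, which is nonnegative since D \<ge> 2 and
      \<open>a\<close>, \<open>b\<close> are unit vectors.\<close>
    have "r \<le> ?N * (c\<^sup>2 + (?N - 1))"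
    proof -
      have "0 \<le> (?N - 2) * (1 - c\<^sup>2)" using N c1 by simp
      then have "1 + (?N - 1) * c\<^sup>2 \<le> c\<^sup>2 + (?N - 1)" by (simp add: algebra_simps)
      then show ?thesis unfolding r_def by (intro mult_left_mono) auto
    qed
    moreover have r0: "r > 0" unfolding r_def using N by (intro mult_pos_pos add_pos_nonneg) auto
    ultimately have "\<bar>p \<bullet> q\<bar> \<ge> \<rho> * r"
      unfolding pq abs_mult power_abs \<rho>_def by (intro mult_left_mono) auto
    moreover have "m * (2 * r) \<le> 2 * r - 2 * \<bar>p \<bullet> q\<bar>"
    proof -
      \<comment> \<open>The choices \<open>s = 1\<close> and \<open>s = -1\<close> together bring in
        the modulus of \<open>p \<bullet> q\<close>, whatever its sign.\<close>
      have "m * ((norm p)\<^sup>2 + (norm (s *\<^sub>R q))\<^sup>2) \<le> (norm (p + s *\<^sub>R q))\<^sup>2" for s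
        using sym[of b "s *\<^sub>R a"] unfolding p_def q_def by (simp add: tangent_map_scaleR)
      from this[of 1] this[of "-1"] show ?thesis
        by (simp add: power2_norm_eq_inner inner_add_left inner_add_right inner_commute pp algebra_simps)
    qed
    ultimately have "m * r \<le> (1 - \<rho>) * r" by (simp add: algebra_simps)
    then show ?thesis using r0 by simp
  qed
  have split: "\<exists>x z. tangent_map p y = tangent_map p (\<lambda>_ :: 'd. x) + tangent_map p z \<and> (\<Sum>k\<in>UNIV. z k) = 0"
    for p :: "real ^ 'n" and y :: "'d \<Rightarrow> real ^ 'n"
  proof -
    define x where "x = (1 / ?N) *\<^sub>R (\<Sum>k\<in>UNIV. y k)"
    have "tangent_map p y = tangent_map p (\<lambda>k. x + (y k - x))" by simp
    also have "\<dots> = tangent_map p (\<lambda>_ :: 'd. x) + tangent_map p (\<lambda>k. y k - x)"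
      by (rule tangent_map_add)
    moreover have "(\<Sum>k\<in>UNIV. y k - x) = 0"
      by (simp add: sum_subtractf x_def sum_constant_scaleR del: sum_constant)
    ultimately show ?thesis by metis
  qed
  obtain x u0 where u: "tangent_map a u = tangent_map a (\<lambda>_ :: 'd. x) + tangent_map a u0"
    and u0: "(\<Sum>k\<in>UNIV. u0 k) = 0" using split by metis
  obtain y w0 where w: "tangent_map b w = tangent_map b (\<lambda>_ :: 'd. y) + tangent_map b w0"
    and w0: "(\<Sum>k\<in>UNIV. w0 k) = 0" using split by metis
  \<comment> \<open>With a constant first family, both terms of \<open>tangent_map_inner\<close> are
    linear in the sum of \<open>z\<close>. The base points are arbitrary, so all four pairs in
    \<open>o\<close> are covered.\<close>
  have orth: "tangent_map p (\<lambda>_ :: 'd. v) \<bullet> tangent_map q z = 0"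
    if "(\<Sum>k\<in>UNIV. z k) = 0" for p q v :: "real ^ 'n" and z :: "'d \<Rightarrow> real ^ 'n"
    using that
    by (simp add: tangent_map_inner[OF D] sum_subtractf
        flip: sum_distrib_left inner_sum_right)
  define P Q P0 Q0 where "P = tangent_map a (\<lambda>_ :: 'd. x)" and "Q = tangent_map b (\<lambda>_ :: 'd. y)"
    and "P0 = tangent_map a u0" and "Q0 = tangent_map b w0"
  have o: "P \<bullet> P0 = 0" "P \<bullet> Q0 = 0" "Q \<bullet> P0 = 0" "Q \<bullet> Q0 = 0"
    unfolding P_def Q_def P0_def Q0_def using orth u0 w0 by simp_all
  then have o': "P0 \<bullet> P = 0" "Q0 \<bullet> P = 0" "P0 \<bullet> Q = 0" "Q0 \<bullet> Q = 0"
    by (simp_all add: inner_commute)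
  have "m * ((norm P0)\<^sup>2 + (norm Q0)\<^sup>2) \<le> (1 - \<rho>) * ((norm P0)\<^sup>2 + (norm Q0)\<^sup>2)"
    using m_le by (intro mult_right_mono) auto
  also have "\<dots> \<le> (norm (P0 + Q0))\<^sup>2"
  proof -
    have "\<bar>P0 \<bullet> Q0\<bar> \<le> \<rho> * (norm P0 * norm Q0)"
      using tangent_map_zero_sum_bound[OF D unit u0 w0]
      unfolding P0_def Q0_def \<rho>_def c_def by (simp add: mult.assoc)
    moreover have "\<rho> * (2 * (norm P0 * norm Q0)) \<le> \<rho> * ((norm P0)\<^sup>2 + (norm Q0)\<^sup>2)"
      using sum_squares_bound[of "norm P0" "norm Q0"]
      by (intro mult_left_mono) (auto simp: \<rho>_def)
    ultimately have "- 2 * (P0 \<bullet> Q0) \<le> \<rho> * ((norm P0)\<^sup>2 + (norm Q0)\<^sup>2)" by linarith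
    then show ?thesis
      by (simp add: power2_norm_eq_inner inner_add_left inner_add_right inner_commute algebra_simps)
  qed
  finally have "m * ((norm P0)\<^sup>2 + (norm Q0)\<^sup>2) \<le> (norm (P0 + Q0))\<^sup>2" .
  moreover have "m * ((norm P)\<^sup>2 + (norm Q)\<^sup>2) \<le> (norm (P + Q))\<^sup>2"
    unfolding P_def Q_def by (rule sym)
  \<comment> \<open>By \<open>o\<close> and \<open>o'\<close> the cross terms vanish, and the claim
    is the sum of the two preceding bounds.\<close>
  ultimately have "m * ((norm (P + P0))\<^sup>2 + (norm (Q + Q0))\<^sup>2) \<le> (norm ((P + P0) + (Q + Q0)))\<^sup>2"
    by (simp add: power2_norm_eq_inner inner_add_left inner_add_right o o' algebra_simps)
  then show ?thesis unfolding u w P_def Q_def P0_def Q0_def .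
qed

section \<open>Tangent spaces of the Segre and Veronese manifolds\<close>

lemma tensor_prod_scaleR:
  "tensor_prod (\<lambda>k. c k *\<^sub>R x k) = (\<Prod>k\<in>UNIV. c k) *\<^sub>R tensor_prod x"
  by (simp add: vec_eq_iff tensor_prod_def prod.distrib)

text \<open>The norms of the factors move into the coefficient, so curves in the manifold need not
  keep their factors on the sphere.\<close>

lemma scaleR_tensor_prod_in_segre:
  assumes "\<alpha> \<noteq> 0" "\<And>k. y k \<noteq> 0"
  shows "\<alpha> *\<^sub>R tensor_prod y \<in> segre"
proof -
  have "tensor_prod y = tensor_prod (\<lambda>k. norm (y k) *\<^sub>R (y k /\<^sub>R norm (y k)))"
    using assms by simp
  also have "\<dots> = (\<Prod>k\<in>UNIV. norm (y k)) *\<^sub>R tensor_prod (\<lambda>k. y k /\<^sub>R norm (y k))"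
    by (rule tensor_prod_scaleR)
  finally have "\<alpha> *\<^sub>R tensor_prod y
      = (\<alpha> * (\<Prod>k\<in>UNIV. norm (y k))) *\<^sub>R tensor_prod (\<lambda>k. y k /\<^sub>R norm (y k))" by simp
  then show ?thesis
    unfolding segre_def using assms
    by (intro CollectI exI[of _ "\<alpha> * (\<Prod>k\<in>UNIV. norm (y k))"] exI[of _ "\<lambda>k. y k /\<^sub>R norm (y k)"]) auto
qed

lemma scaleR_tensor_power_in_veronese:
  assumes "\<alpha> \<noteq> 0" "y \<noteq> 0"
  shows "\<alpha> *\<^sub>R tensor_power y \<in> (veronese :: ('n::finite, 'd::finite) tensor set)"
proof -
  have "tensor_power y = (tensor_prod (\<lambda>k. norm y *\<^sub>R (y /\<^sub>R norm y)) :: ('n, 'd) tensor)"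
    using assms by (simp add: tensor_power_def)
  also have "\<dots> = norm y ^ CARD('d) *\<^sub>R tensor_power (y /\<^sub>R norm y)"
    unfolding tensor_power_def by (subst tensor_prod_scaleR) simp
  finally have "\<alpha> *\<^sub>R tensor_power y
      = (\<alpha> * norm y ^ CARD('d)) *\<^sub>R (tensor_power (y /\<^sub>R norm y) :: ('n, 'd) tensor)" by simp
  then show ?thesis
    unfolding veronese_def using assms
    by (intro CollectI exI[of _ "\<alpha> * norm y ^ CARD('d)"] exI[of _ "y /\<^sub>R norm y"]) auto
qed

lemma veronese_subset_segre: "veronese \<subseteq> segre"
  unfolding veronese_def segre_def tensor_power_def by blast

text \<open>The vector is the velocity of the curve in \<open>M\<close>; dividing \<open>t\<close>
  by \<alpha> cancels the leading coefficient. \<open>M\<close> is kept general so that the same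
  curve serves both manifolds.\<close>

lemma tangent_map_in_tangent_space:
  fixes a :: "real ^ 'n::finite" and u :: "'d::finite \<Rightarrow> real ^ 'n"
  assumes "\<alpha> \<noteq> 0" "norm a = 1"
    and M: "\<And>t. (\<And>k. a + (t / \<alpha>) *\<^sub>R u k \<noteq> 0) \<Longrightarrow> \<alpha> *\<^sub>R tensor_prod (\<lambda>k. a + (t / \<alpha>) *\<^sub>R u k) \<in> M"
  shows "tangent_map a u \<in> tangent_space M (\<alpha> *\<^sub>R tensor_power a)"
proof -
  define \<gamma> where "\<gamma> t = \<alpha> *\<^sub>R tensor_prod (\<lambda>k. a + (t / \<alpha>) *\<^sub>R u k)" for t
  \<comment> \<open>For \<open>t\<close> in this range every
    \<open>(t / \<alpha>) *\<^sub>R u k\<close> is shorter than the unit vector \<open>a\<close>, so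
    no factor vanishes. The summand 1 keeps the denominator positive.\<close>
  define \<epsilon> where "\<epsilon> = \<bar>\<alpha>\<bar> / (1 + (\<Sum>k\<in>UNIV. norm (u k)))"
  have pos: "1 + (\<Sum>k\<in>UNIV. norm (u k)) > 0" by (simp add: add_pos_nonneg sum_nonneg)
  have \<epsilon>: "\<epsilon> > 0" using assms pos by (simp add: \<epsilon>_def)
  have "\<gamma> t \<in> M" if t: "t \<in> {-\<epsilon><..<\<epsilon>}" for t
    unfolding \<gamma>_def
  proof (rule M)
    fix k
    have "\<bar>t\<bar> < \<epsilon>" using t by auto
    then have "\<bar>t\<bar> * (1 + (\<Sum>k\<in>UNIV. norm (u k))) < \<bar>\<alpha>\<bar>"
      using pos by (simp add: \<epsilon>_def pos_less_divide_eq)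
    moreover have "norm (u k) \<le> 1 + (\<Sum>k\<in>UNIV. norm (u k))"
      using member_le_sum[of k UNIV "\<lambda>k. norm (u k)"] by simp
    ultimately have "\<bar>t\<bar> * norm (u k) < \<bar>\<alpha>\<bar>"
      by (meson abs_ge_zero mult_left_mono order_le_less_trans)
    then have "norm ((t / \<alpha>) *\<^sub>R u k) < norm a" using assms by (simp add: divide_less_eq)
    then show "a + (t / \<alpha>) *\<^sub>R u k \<noteq> 0"
      by (metis add_eq_0_iff norm_minus_cancel order_less_irrefl)
  qed
  moreover have nth: "\<gamma> t $ i = \<alpha> * (\<Prod>k\<in>UNIV. a $ i k + t * (u k $ i k / \<alpha>))" for t i
    by (simp add: \<gamma>_def tensor_prod_def)
  \<comment> \<open>Polynomial coordinates give a derivative that is again polynomial, hence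
    continuous.\<close>
  have "polynomial_function \<gamma>"
    unfolding polynomial_function_iff_Basis_inner
  proof
    fix e :: "('n, 'd) tensor" assume "e \<in> Basis"
    then obtain i where e: "e = axis i 1" by (auto simp: Basis_vec_def)
    have "real_polynomial_function (\<lambda>t. \<alpha> * (\<Prod>k\<in>UNIV. a $ i k + t * (u k $ i k / \<alpha>)))"
      by (intro real_polynomial_function_prod real_polynomial_function.intros
          bounded_linear_ident finite)
    then show "real_polynomial_function (\<lambda>t. \<gamma> t \<bullet> e)" by (simp add: e inner_axis nth)
  qed
  then obtain \<gamma>' where \<gamma>': "polynomial_function \<gamma>'" "\<And>t. (\<gamma> has_vector_derivative \<gamma>' t) (at t)"
    using has_vector_derivative_polynomial_function by blast
  then have "\<gamma> C1_differentiable_on {-\<epsilon><..<\<epsilon>}"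
    unfolding C1_differentiable_on_def using continuous_on_polymonial_function by blast
  moreover have "\<gamma>' 0 = tangent_map a u"
  proof -
    have "\<gamma>' 0 $ i = tangent_map a u $ i" for i
    proof -
      have "((\<lambda>t. \<gamma> t $ i) has_real_derivative \<gamma>' 0 $ i) (at 0)"
        using bounded_linear.has_vector_derivative[OF bounded_linear_vec_nth \<gamma>'(2)]
        by (simp add: has_real_derivative_iff_has_vector_derivative)
      moreover have "((\<lambda>t. \<gamma> t $ i) has_real_derivative tangent_map a u $ i) (at 0)"
      proof -
        have deriv: "((\<lambda>t. \<Prod>k\<in>UNIV. a $ i k + t * (u k $ i k / \<alpha>)) has_real_derivative
            (\<Sum>k\<in>UNIV. u k $ i k / \<alpha> * (\<Prod>l\<in>UNIV - {k}. a $ i l + 0 * (u l $ i l / \<alpha>)))) (at 0)"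
          by (rule has_field_derivative_prod) (auto intro!: derivative_eq_intros simp: assms(1))
        have eq: "\<alpha> * (\<Sum>k\<in>UNIV. u k $ i k / \<alpha> * (\<Prod>l\<in>UNIV - {k}. a $ i l + 0 * (u l $ i l / \<alpha>)))
            = tangent_map a u $ i"
          using assms(1) by (simp add: tangent_map_nth sum_distrib_left)
        show ?thesis unfolding nth using DERIV_cmult[OF deriv, of \<alpha>] unfolding eq .
      qed
      ultimately show ?thesis by (rule DERIV_unique)
    qed
    then show ?thesis by (simp add: vec_eq_iff)
  qed
  moreover have "\<gamma> 0 = \<alpha> *\<^sub>R tensor_power a" by (simp add: \<gamma>_def tensor_power_def)
  ultimately show ?thesis
    unfolding tangent_space_def using \<epsilon> \<gamma>'(2)[of 0] by (auto intro!: exI[of _ \<epsilon>] exI[of _ \<gamma>])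
qed

text \<open>Contraction of every slot except \<open>k\<close> with \<open>a\<close>. It is linear in
  \<open>B\<close> and sends a rank-one tensor to a multiple of its factor in slot
  \<open>k\<close>.\<close>

definition contraction ::
    "real ^ 'n::finite \<Rightarrow> 'd::finite \<Rightarrow> ('n, 'd) tensor \<Rightarrow> real ^ 'n" where
  "contraction a k B = (\<chi> j. B \<bullet> tensor_prod ((\<lambda>_. a)(k := axis j 1)))"

lemma contraction_tensor_prod:
  "contraction a k (\<beta> *\<^sub>R tensor_prod x) = (\<beta> * (\<Prod>l\<in>UNIV - {k}. x l \<bullet> a)) *\<^sub>R x k"
  by (simp add: vec_eq_iff contraction_def tensor_prod_inner inner_axis
      prod_fun_upd[where f = "\<lambda>v l. x l \<bullet> v"] del: fun_upd_apply)

text \<open>Each \<open>e l\<close> is left out exactly once, at \<open>k = l\<close>; exchanging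
  the products counts its remaining occurrences.\<close>

lemma prod_prod_delete:
  fixes e :: "'d::finite \<Rightarrow> 'a::comm_semiring_1"
  shows "(\<Prod>k\<in>UNIV. \<Prod>l\<in>UNIV - {k}. e l) = (\<Prod>l\<in>UNIV. e l) ^ (CARD('d) - 1)"
proof -
  have "(\<Prod>k\<in>UNIV. \<Prod>l\<in>UNIV - {k}. e l) = (\<Prod>k\<in>UNIV. \<Prod>l\<in>{l \<in> UNIV. k \<noteq> l}. e l)"
    by (intro prod.cong) auto
  also have "\<dots> = (\<Prod>l\<in>UNIV. \<Prod>k\<in>{k \<in> UNIV. k \<noteq> l}. e l)"
    by (rule prod.swap_restrict) auto
  also have "\<dots> = (\<Prod>l\<in>UNIV. e l ^ (CARD('d) - 1))"
  proof (intro prod.cong refl)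
    fix l :: 'd
    have "{k \<in> UNIV. k \<noteq> l} = UNIV - {l}" by auto
    then show "(\<Prod>k\<in>{k \<in> UNIV. k \<noteq> l}. e l) = e l ^ (CARD('d) - 1)"
      by (simp add: card_Diff_singleton)
  qed
  finally show ?thesis by (simp only: prod_power_distrib)
qed

text \<open>This identity is polynomial in \<open>B\<close>, so it can be differentiated along a curve in the Segre
  manifold without choosing the rank-one factors smoothly.\<close>

lemma segre_contraction:
  fixes B :: "('n::finite, 'd::finite) tensor"
  assumes "B \<in> segre"
  shows "(B \<bullet> tensor_power a) ^ (CARD('d) - 1) *\<^sub>R B = tensor_prod (\<lambda>k. contraction a k B)"
proof -
  obtain \<beta> x where B: "B = \<beta> *\<^sub>R tensor_prod x" using assms by (auto simp: segre_def)
  let ?e = "\<Prod>l\<in>UNIV. x l \<bullet> a"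
  have "tensor_prod (\<lambda>k. contraction a k B)
      = (\<beta> ^ CARD('d) * ?e ^ (CARD('d) - 1)) *\<^sub>R tensor_prod x"
    by (simp add: B contraction_tensor_prod tensor_prod_scaleR prod.distrib prod_prod_delete)
  moreover have "\<beta> ^ CARD('d) = \<beta> ^ (CARD('d) - 1) * \<beta>"
    by (metis power_minus_mult zero_less_card_finite)
  ultimately show ?thesis
    by (simp add: B tensor_power_def tensor_prod_inner power_mult_distrib)
qed

lemma DERIV_unique_ev:
  assumes "(f has_real_derivative u) (at x)" "(g has_real_derivative v) (at x)"
    and "\<forall>\<^sub>F y in nhds x. f y = g y"
  shows "u = v"
  using assms DERIV_cong_ev[OF refl assms(3) refl] DERIV_unique by metis

text \<open>Differentiating \<open>segre_contraction\<close> along the curve at 0 and cancelling a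
  power of \<alpha> expresses \<open>v\<close> as the tangent map of its contractions minus a
  multiple of \<open>tensor_power a\<close>. That multiple is the tangent map of a constant family,
  so a single \<open>s\<close> serves all slots, which the Veronese case relies on.\<close>

lemma segre_velocity:
  fixes a :: "real ^ 'n::finite" and \<gamma> :: "real \<Rightarrow> ('n, 'd::finite) tensor"
  assumes "CARD('d) \<ge> 2" "\<alpha> \<noteq> 0" "norm a = 1" "\<epsilon> > 0"
    and segre: "\<And>t. t \<in> {-\<epsilon><..<\<epsilon>} \<Longrightarrow> \<gamma> t \<in> segre"
    and \<gamma>0: "\<gamma> 0 = \<alpha> *\<^sub>R tensor_power a"
    and v: "(\<gamma> has_vector_derivative v) (at 0)"
  obtains s where "v = tangent_map a (\<lambda>k. contraction a k v - s *\<^sub>R a)"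
proof -
  \<comment> \<open>The exponents D - 1 and D - 2 become \<open>Suc M\<close> and \<open>M\<close>,
    without truncated subtraction.\<close>
  obtain M where N: "CARD('d) = Suc (Suc M)"
    using assms(1) by (metis Suc_le_D numeral_2_eq_2 Suc_le_mono)
  have aa: "a \<bullet> a = 1" using assms by (simp add: dot_square_norm)
  have inn: "((\<lambda>t. \<gamma> t \<bullet> q) has_real_derivative v \<bullet> q) (at 0)" for q
    using bounded_linear.has_vector_derivative[OF bounded_linear_inner_left v]
    by (simp add: has_real_derivative_iff_has_vector_derivative)
  have nth: "((\<lambda>t. \<gamma> t $ i) has_real_derivative v $ i) (at 0)" for i
    using bounded_linear.has_vector_derivative[OF bounded_linear_vec_nth v]
    by (simp add: has_real_derivative_iff_has_vector_derivative)
  have g0: "\<gamma> 0 \<bullet> tensor_power a = \<alpha>"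
    by (simp add: \<gamma>0 tensor_power_def tensor_prod_inner aa)
  have \<gamma>0_nth: "\<gamma> 0 $ i = \<alpha> * tensor_power a $ i" for i by (simp add: \<gamma>0)
  have c0: "contraction a k (\<gamma> 0) = \<alpha> *\<^sub>R a" for k
    by (simp add: \<gamma>0 tensor_power_def contraction_tensor_prod aa)
  let ?g = "v \<bullet> tensor_power a"
  have "v $ i = tangent_map a (\<lambda>k. contraction a k v) $ i - real (Suc M) * ?g * tensor_power a $ i" for i
  proof -
    let ?L = "\<lambda>t. (\<gamma> t \<bullet> tensor_power a) ^ Suc M * \<gamma> t $ i"
    let ?R = "\<lambda>t. \<Prod>k\<in>UNIV. contraction a k (\<gamma> t) $ i k"
    have "(?L has_real_derivative
        real (Suc M) * \<alpha> ^ M * ?g * (\<alpha> * tensor_power a $ i) + \<alpha> ^ Suc M * v $ i) (at 0)"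
      by (rule derivative_eq_intros inn nth refl)+ (simp add: g0 \<gamma>0_nth)
    moreover have "(?R has_real_derivative
        (\<Sum>k\<in>UNIV. contraction a k v $ i k * (\<Prod>l\<in>UNIV - {k}. contraction a l (\<gamma> 0) $ i l))) (at 0)"
      by (rule has_field_derivative_prod) (simp add: contraction_def inn)
    moreover have "\<forall>\<^sub>F t in nhds 0. ?L t = ?R t"
    proof (rule eventually_nhds_in_open[THEN eventually_mono])
      show "open {-\<epsilon><..<\<epsilon>}" "0 \<in> {-\<epsilon><..<\<epsilon>}" using \<open>\<epsilon> > 0\<close> by auto
      fix t assume "t \<in> {-\<epsilon><..<\<epsilon>}"
      then have "((\<gamma> t \<bullet> tensor_power a) ^ (CARD('d) - 1) *\<^sub>R \<gamma> t) $ i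
          = tensor_prod (\<lambda>k. contraction a k (\<gamma> t)) $ i"
        using segre_contraction[OF segre] by metis
      then show "?L t = ?R t" by (simp add: N tensor_prod_def)
    qed
    ultimately have "real (Suc M) * \<alpha> ^ M * ?g * (\<alpha> * tensor_power a $ i) + \<alpha> ^ Suc M * v $ i
      = (\<Sum>k\<in>UNIV. contraction a k v $ i k * (\<Prod>l\<in>UNIV - {k}. contraction a l (\<gamma> 0) $ i l))"
      by (rule DERIV_unique_ev)
    also have "\<dots> = \<alpha> ^ Suc M * tangent_map a (\<lambda>k. contraction a k v) $ i"
      by (simp add: c0 prod.distrib card_Diff_singleton N tangent_map_nth sum_distrib_left mult_ac)
    finally have "\<alpha> ^ Suc M * (real (Suc M) * ?g * tensor_power a $ i + v $ i)
        = \<alpha> ^ Suc M * tangent_map a (\<lambda>k. contraction a k v) $ i"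
      by (simp add: algebra_simps)
    then show ?thesis using assms(2) by simp
  qed
  then have "v = tangent_map a (\<lambda>k. contraction a k v) - (real (Suc M) * ?g) *\<^sub>R tensor_power a"
    by (simp add: vec_eq_iff)
  also have "(real (Suc M) * ?g) *\<^sub>R tensor_power a
      = tangent_map a (\<lambda>_ :: 'd. (real (Suc M) * ?g / real CARD('d)) *\<^sub>R a)"
    by (simp add: tangent_map_scaleR tangent_map_self)
  finally show thesis by (intro that) (simp only: tangent_map_diff)
qed

lemma tangent_space_segre:
  fixes a :: "real ^ 'n::finite"
  assumes "CARD('d::finite) \<ge> 2" "\<alpha> \<noteq> 0" "norm a = 1"
  shows "tangent_space segre (\<alpha> *\<^sub>R tensor_power a)
    = range (tangent_map a :: ('d \<Rightarrow> real ^ 'n) \<Rightarrow> ('n, 'd) tensor)"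
proof
  show "tangent_space segre (\<alpha> *\<^sub>R tensor_power a)
      \<subseteq> range (tangent_map a :: ('d \<Rightarrow> real ^ 'n) \<Rightarrow> ('n, 'd) tensor)"
  proof
    fix v :: "('n, 'd) tensor" assume "v \<in> tangent_space segre (\<alpha> *\<^sub>R tensor_power a)"
    then obtain \<epsilon> \<gamma> where "\<epsilon> > 0" "\<gamma> ` {-\<epsilon><..<\<epsilon>} \<subseteq> segre" "\<gamma> 0 = \<alpha> *\<^sub>R tensor_power a"
      "(\<gamma> has_vector_derivative v) (at 0)" unfolding tangent_space_def by blast
    then obtain s where "v = tangent_map a (\<lambda>k. contraction a k v - s *\<^sub>R a)"
      using segre_velocity[OF assms, of \<epsilon> \<gamma> v] by (metis image_subset_iff)
    then show "v \<in> range (tangent_map a)" by (metis rangeI)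
  qed
  show "range (tangent_map a :: ('d \<Rightarrow> real ^ 'n) \<Rightarrow> ('n, 'd) tensor)
      \<subseteq> tangent_space segre (\<alpha> *\<^sub>R tensor_power a)"
    by (intro image_subsetI tangent_map_in_tangent_space scaleR_tensor_prod_in_segre assms)
qed

lemma veronese_contraction:
  assumes "B \<in> veronese"
  shows "contraction a k B = contraction a l B"
proof -
  obtain \<beta> x where B: "B = \<beta> *\<^sub>R tensor_prod (\<lambda>_. x)"
    using assms by (auto simp: veronese_def tensor_power_def)
  show ?thesis unfolding B contraction_tensor_prod by (simp add: card_Diff_singleton)
qed

text \<open>A curve in the Veronese manifold is also a Segre curve, so \<open>segre_velocity\<close>
  applies. Its contractions in different slots agree along the curve, hence so do their derivatives,
  and the family found there is constant.\<close>

lemma tangent_space_veronese: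
  fixes a :: "real ^ 'n::finite"
  assumes "CARD('d::finite) \<ge> 2" "\<alpha> \<noteq> 0" "norm a = 1"
  shows "tangent_space veronese (\<alpha> *\<^sub>R tensor_power a)
    = range (\<lambda>x. tangent_map a (\<lambda>_ :: 'd. x))"
proof
  show "tangent_space veronese (\<alpha> *\<^sub>R tensor_power a) \<subseteq> range (\<lambda>x. tangent_map a (\<lambda>_ :: 'd. x))"
  proof
    fix v :: "('n, 'd) tensor" assume "v \<in> tangent_space veronese (\<alpha> *\<^sub>R tensor_power a)"
    then obtain \<epsilon> \<gamma> where \<epsilon>: "\<epsilon> > 0" and ver: "\<gamma> ` {-\<epsilon><..<\<epsilon>} \<subseteq> veronese"
      and \<gamma>0: "\<gamma> 0 = \<alpha> *\<^sub>R tensor_power a" and v: "(\<gamma> has_vector_derivative v) (at 0)"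
      unfolding tangent_space_def by blast
    then obtain s where s: "v = tangent_map a (\<lambda>k. contraction a k v - s *\<^sub>R a)"
      using segre_velocity[OF assms, of \<epsilon> \<gamma> v] veronese_subset_segre
      by (metis image_subset_iff subset_iff)
    have "contraction a k v = contraction a l v" for k l
    proof -
      have "contraction a k v $ j = contraction a l v $ j" for j
      proof -
        have deriv: "((\<lambda>t. contraction a k (\<gamma> t) $ j) has_real_derivative contraction a k v $ j) (at 0)" for k
          using bounded_linear.has_vector_derivative[OF bounded_linear_inner_left v]
          by (simp add: contraction_def has_real_derivative_iff_has_vector_derivative)
        have "\<forall>\<^sub>F t in nhds 0. contraction a k (\<gamma> t) $ j = contraction a l (\<gamma> t) $ j"
        proof (rule eventually_nhds_in_open[THEN eventually_mono])
          show "open {-\<epsilon><..<\<epsilon>}" "0 \<in> {-\<epsilon><..<\<epsilon>}" using \<epsilon> by auto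
          show "contraction a k (\<gamma> t) $ j = contraction a l (\<gamma> t) $ j" if "t \<in> {-\<epsilon><..<\<epsilon>}" for t
            using veronese_contraction ver that by (metis image_subset_iff)
        qed
        then show ?thesis by (rule DERIV_unique_ev[OF deriv deriv])
      qed
      then show ?thesis by (simp add: vec_eq_iff)
    qed
    \<comment> \<open>\<open>undefined\<close> stands for an arbitrary slot; the contraction is the
      same in all of them.\<close>
    then have "(\<lambda>k. contraction a k v - s *\<^sub>R a) = (\<lambda>_. contraction a undefined v - s *\<^sub>R a)"
      by metis
    then show "v \<in> range (\<lambda>x. tangent_map a (\<lambda>_ :: 'd. x))" using s by (metis rangeI)
  qed
  have "tangent_map a (\<lambda>_ :: 'd. x) \<in> tangent_space veronese (\<alpha> *\<^sub>R tensor_power a)" for x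
    using scaleR_tensor_power_in_veronese[OF assms(2)]
    by (intro tangent_map_in_tangent_space[OF assms(2,3)]) (simp flip: tensor_power_def)
  then show "range (\<lambda>x. tangent_map a (\<lambda>_ :: 'd. x)) \<subseteq> tangent_space veronese (\<alpha> *\<^sub>R tensor_power a)"
    by blast
qed

section \<open>Condition numbers of one and two summands\<close>

lemma subspace_range_tangent_map:
  fixes a :: "real ^ 'n::finite"
  shows "subspace (range (tangent_map a) :: ('n, 'd::finite) tensor set)"
proof (rule subspaceI)
  show "0 \<in> (range (tangent_map a) :: ('n, 'd) tensor set)"
    using tangent_map_scaleR[of a 0 "\<lambda>_. 0"] by (intro range_eqI[of _ _ "\<lambda>_. 0"]) simp
next
  fix x y :: "('n, 'd) tensor" assume "x \<in> range (tangent_map a)" "y \<in> range (tangent_map a)"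
  then obtain u w where "x = tangent_map a u" "y = tangent_map a w" by (elim rangeE)
  then have "x + y = tangent_map a (\<lambda>k. u k + w k)" by (simp only: tangent_map_add)
  then show "x + y \<in> range (tangent_map a)" by (simp only: rangeI)
next
  fix s and x :: "('n, 'd) tensor" assume "x \<in> range (tangent_map a)"
  then obtain u where "x = tangent_map a u" by (elim rangeE)
  then have "s *\<^sub>R x = tangent_map a (\<lambda>k. s *\<^sub>R u k)" by (simp only: tangent_map_scaleR)
  then show "s *\<^sub>R x \<in> range (tangent_map a)" by (simp only: rangeI)
qed

lemma subspace_range_tangent_map_const:
  fixes a :: "real ^ 'n::finite"
  shows "subspace (range (\<lambda>x. tangent_map a (\<lambda>_ :: 'd::finite. x)))"
proof (rule subspaceI)
  show "0 \<in> range (\<lambda>x. tangent_map a (\<lambda>_ :: 'd. x))"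
    using tangent_map_scaleR[of a 0 "\<lambda>_. 0"] by (intro range_eqI[of _ _ "0"]) simp
next
  fix x y :: "('n, 'd) tensor" assume "x \<in> range (\<lambda>x. tangent_map a (\<lambda>_ :: 'd. x))" "y \<in> range (\<lambda>x. tangent_map a (\<lambda>_ :: 'd. x))"
  then obtain u w where "x = tangent_map a (\<lambda>_ :: 'd. u)" "y = tangent_map a (\<lambda>_ :: 'd. w)" by (elim rangeE)
  then have "x + y = tangent_map a (\<lambda>_ :: 'd. u + w)" by (simp only: tangent_map_add)
  then show "x + y \<in> range (\<lambda>x. tangent_map a (\<lambda>_ :: 'd. x))" by blast
next
  fix s and x :: "('n, 'd) tensor" assume "x \<in> range (\<lambda>x. tangent_map a (\<lambda>_ :: 'd. x))"
  then obtain u where "x = tangent_map a (\<lambda>_ :: 'd. u)" by (elim rangeE)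
  then have "s *\<^sub>R x = tangent_map a (\<lambda>_ :: 'd. s *\<^sub>R u)" by (simp only: tangent_map_scaleR)
  then show "s *\<^sub>R x \<in> range (\<lambda>x. tangent_map a (\<lambda>_ :: 'd. x))" by blast
qed

lemma veronese_tangent_spaces:
  fixes P :: "('n::finite, 'd::finite) tensor"
  assumes "CARD('d) \<ge> 2" "P \<in> veronese"
  obtains a :: "real ^ 'n" where "norm a = 1"
    "tangent_space segre P = range (tangent_map a)"
    "tangent_space veronese P = range (\<lambda>x. tangent_map a (\<lambda>_ :: 'd. x))"
proof -
  obtain \<alpha> a where "P = \<alpha> *\<^sub>R tensor_power a" "\<alpha> \<noteq> 0" "norm a = 1"
    using assms(2) by (auto simp: veronese_def)
  then show thesis
    using that tangent_space_segre[OF assms(1)] tangent_space_veronese[OF assms(1)] by metis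
qed

text \<open>Provides the nonzero vector that \<open>Inf_norm_sum_eqI\<close> asks for: the power of
  a unit vector has norm 1.\<close>

lemma tangent_map_self_nonzero:
  assumes "norm a = 1"
  shows "tangent_map a (\<lambda>_ :: 'd::finite. a) \<noteq> 0"
proof -
  have "tensor_power a \<bullet> (tensor_power a :: (_, 'd) tensor) = 1"
    using assms by (simp only: tensor_power_def tensor_prod_inner) (simp add: dot_square_norm)
  then have "tensor_power a \<noteq> (0 :: (_, 'd) tensor)" by auto
  then show ?thesis by (simp add: tangent_map_self)
qed

text \<open>The zero space with the empty basis acts as a second summand, so that
  \<open>sigma_min_append\<close> and \<open>Inf_norm_sum_eqI\<close> handle one summand as
  well.\<close>

lemma condition_number_single:
  assumes "subspace (tangent_space M P)"
  shows "condition_number M [P] = inverse (Inf {ennreal (norm (u + w)) | u w.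
    u \<in> tangent_space M P \<and> w \<in> {0} \<and> (norm u)\<^sup>2 + (norm w)\<^sup>2 = 1})"
  using sigma_min_append[OF someI_ex[OF orthonormal_basis_of_exists[OF assms]] orthonormal_basis_of_empty]
  by (simp add: condition_number_def)

lemma condition_number_pair:
  assumes "subspace (tangent_space M P)" "subspace (tangent_space M Q)"
  shows "condition_number M [P, Q] = inverse (Inf {ennreal (norm (u + w)) | u w.
    u \<in> tangent_space M P \<and> w \<in> tangent_space M Q \<and> (norm u)\<^sup>2 + (norm w)\<^sup>2 = 1})"
  using sigma_min_append[OF someI_ex[OF orthonormal_basis_of_exists[OF assms(1)]]
      someI_ex[OF orthonormal_basis_of_exists[OF assms(2)]]]
  by (simp add: condition_number_def)

lemma condition_number_veronese_single:
  fixes P :: "('n::finite, 'd::finite) tensor"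
  assumes "CARD('d) \<ge> 2" "P \<in> veronese"
  shows "condition_number veronese [P] = condition_number segre [P]"
proof -
  obtain a :: "real ^ 'n" where a: "norm a = 1"
    "tangent_space segre P = range (tangent_map a)"
    "tangent_space veronese P = range (\<lambda>x. tangent_map a (\<lambda>_ :: 'd. x))"
    using veronese_tangent_spaces[OF assms] by blast
  let ?x = "tangent_map a (\<lambda>_ :: 'd. a)"
  have "Inf {ennreal (norm (u + w)) | u w. u \<in> tangent_space veronese P \<and> w \<in> {0} \<and> (norm u)\<^sup>2 + (norm w)\<^sup>2 = 1}
    = Inf {ennreal (norm (u + w)) | u w. u \<in> tangent_space segre P \<and> w \<in> {0} \<and> (norm u)\<^sup>2 + (norm w)\<^sup>2 = 1}"
  proof (rule Inf_norm_sum_eqI[where x = ?x])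
    fix m and u w :: "('n, 'd) tensor"
    assume m: "\<And>u w. u \<in> tangent_space veronese P \<Longrightarrow> w \<in> {0} \<Longrightarrow>
      m * ((norm u)\<^sup>2 + (norm w)\<^sup>2) \<le> (norm (u + w))\<^sup>2" and w: "w \<in> {0 :: ('n, 'd) tensor}"
    \<comment> \<open>Testing at \<open>?x\<close> alone gives \<open>m \<le> 1\<close>, and with
      \<open>w = 0\<close> nothing more is required.\<close>
    have "m * (norm ?x)\<^sup>2 \<le> (norm ?x)\<^sup>2" using m[of ?x 0] a(3) by auto
    then have "m \<le> 1" using tangent_map_self_nonzero[OF a(1), where 'd = 'd] by simp
    then have "m * (norm u)\<^sup>2 \<le> 1 * (norm u)\<^sup>2" by (intro mult_right_mono) auto
    then show "m * ((norm u)\<^sup>2 + (norm w)\<^sup>2) \<le> (norm (u + w))\<^sup>2" using w by simp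
  qed (use a tangent_map_self_nonzero[OF a(1)] subspace_range_tangent_map_const in auto)
  then show ?thesis
    by (simp only: condition_number_single a(2,3) subspace_range_tangent_map
        subspace_range_tangent_map_const)
qed

lemma condition_number_veronese_pair:
  fixes P Q :: "('n::finite, 'd::finite) tensor"
  assumes D: "CARD('d) \<ge> 2" and "P \<in> veronese" "Q \<in> veronese"
  shows "condition_number veronese [P, Q] = condition_number segre [P, Q]"
proof -
  obtain a :: "real ^ 'n" where a: "norm a = 1"
    "tangent_space segre P = range (tangent_map a)"
    "tangent_space veronese P = range (\<lambda>x. tangent_map a (\<lambda>_ :: 'd. x))"
    using veronese_tangent_spaces[OF D assms(2)] by blast
  obtain b :: "real ^ 'n" where b: "norm b = 1"
    "tangent_space segre Q = range (tangent_map b)"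
    "tangent_space veronese Q = range (\<lambda>x. tangent_map b (\<lambda>_ :: 'd. x))"
    using veronese_tangent_spaces[OF D assms(3)] by blast
  have "Inf {ennreal (norm (u + w)) | u w. u \<in> tangent_space veronese P \<and>
      w \<in> tangent_space veronese Q \<and> (norm u)\<^sup>2 + (norm w)\<^sup>2 = 1}
    = Inf {ennreal (norm (u + w)) | u w. u \<in> tangent_space segre P \<and>
      w \<in> tangent_space segre Q \<and> (norm u)\<^sup>2 + (norm w)\<^sup>2 = 1}"
  proof (rule Inf_norm_sum_eqI[where x = "tangent_map a (\<lambda>_ :: 'd. a)"])
    fix m and u w :: "('n, 'd) tensor"
    assume m: "\<And>u w. u \<in> tangent_space veronese P \<Longrightarrow> w \<in> tangent_space veronese Q \<Longrightarrow>
        m * ((norm u)\<^sup>2 + (norm w)\<^sup>2) \<le> (norm (u + w))\<^sup>2"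
      and u: "u \<in> tangent_space segre P" and w: "w \<in> tangent_space segre Q"
    obtain u' w' where "u = tangent_map a u'" "w = tangent_map b w'"
      using u w a(2) b(2) by blast
    then show "m * ((norm u)\<^sup>2 + (norm w)\<^sup>2) \<le> (norm (u + w))\<^sup>2"
      using norm_add_sq_bound_extend[OF D a(1) b(1), of m u' w'] m a(3) b(3) by blast
  qed (use a b tangent_map_self_nonzero[OF a(1)] subspace_range_tangent_map_const in auto)
  then show ?thesis
    by (simp only: condition_number_pair a(2,3) b(2,3) subspace_range_tangent_map
        subspace_range_tangent_map_const)
qed

theorem proposition1p3:
  fixes A :: "('n::finite, 'd::finite) tensor"
    and As :: "('n, 'd) tensor list"
  assumes "CARD('d) \<ge> 3"
    and "length As \<le> 2"
    and "symmetric_tensor A"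
    and "waring_decomposition A As"
  shows "condition_number veronese As = condition_number segre As"
proof -
  have D: "CARD('d) \<ge> 2" using assms(1) by simp
  have ver: "set As \<subseteq> veronese" using assms(4) by (simp add: waring_decomposition_def)
  consider "As = []" | P where "As = [P]" | P Q where "As = [P, Q]"
    using assms(2) by (cases As rule: remdups_adj.cases) auto
  then show ?thesis
  proof cases
    \<comment> \<open>Neither matrix has columns, so both sides reduce to the same term.\<close>
    case 1
    then show ?thesis by (simp add: condition_number_def)
  next
    case 2
    then show ?thesis using condition_number_veronese_single[OF D] ver by simp
  next
    case 3
    then show ?thesis using condition_number_veronese_pair[OF D, of P Q] ver by simp
  qed
qed

end
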